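(* Let $G$ be a graph. For every integer $\ell\ge1$ and every $\mathbb{Z}_\ell$-voltage assignment $\alpha$ on $G$, the cyclic cover $\widetilde G(\alpha,\ell)$ satisfies $\Gamma(\widetilde G(\alpha,\ell))\le\Gamma(G)$.
   Context: All graphs are finite and loopless, but may have parallel edges; $|H|$ denotes the number of vertices of $H$. The density of a graph $G$ is $$\Gamma(G)=\max_{H\subseteq G,\ |H|\ge2}\left\lceil\frac{|E(H)|}{\lfloor|H|/2\rfloor}\right\rceil,$$ the maximum being over all subgraphs $H$ of $G$ with at least two vertices (with $\Gamma(G)=0$ by convention if $G$ has fewer than two vertices). Fix an arbitrary reference orientation of $G$; each edge $e$ has a tail $t(e)$ and a head $h(e)$. $\mathbb{Z}_\ell$ is the additive cyclic group of residues modulo $\ell$. A $\mathbb{Z}_\ell$-voltage assignment on $G$ is a function $\alpha:E(G)\to\mathbb{Z}_\ell$. The $\ell$-fold cyclic cover $\widetilde G(\alpha,\ell)$ of $G$ derived from $\alpha$ is the graph with vertex set $V(G)\times\mathbb{Z}_\ell$ and edge set $E(G)\times\mathbb{Z}_\ell$, where the edge $(e,i)$ joins $(t(e),i)$ and $(h(e),i+\alpha(e))$. *)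

theory Defs
  imports Complex_Main "HOL-Algebra.Elementary_Groups" "Graph_Theory.Digraph_Component"
begin

text \<open>
  A finite loopless graph, possibly with parallel edges, is represented together with a reference
  orientation, as a \<open>pre_digraph\<close> in \<open>fin_digraph\<close> and \<open>loopfree_digraph\<close>: its arcs are the
  edges of the graph, each occurring once, and \<open>tail\<close> and \<open>head\<close> are the maps \<open>t\<close> and \<open>h\<close>.
  Antiparallel arcs are thus parallel edges. Subgraphs of the graph are exactly the subgraphs of
  the oriented graph, so \<open>density\<close> does not depend on the orientation.
\<close>

definition density :: "('a, 'b) pre_digraph \<Rightarrow> int" where
  "density G =
    (if card (verts G) < 2 then 0
     else Max {\<lceil>real (card (arcs H)) / real_of_int \<lfloor>real (card (verts H)) / 2\<rfloor>\<rceil> | H.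
                 subgraph H G \<and> card (verts H) \<ge> 2})"

definition cyclic_cover ::
  "('a, 'b) pre_digraph \<Rightarrow> nat \<Rightarrow> ('b \<Rightarrow> int) \<Rightarrow> ('a \<times> int, 'b \<times> int) pre_digraph" where
  "cyclic_cover G l \<alpha> =
    \<lparr>verts = verts G \<times> carrier (integer_mod_group l),
     arcs = arcs G \<times> carrier (integer_mod_group l),
     tail = (\<lambda>(e, i). (tail G e, i)),
     head = (\<lambda>(e, i). (head G e, i \<otimes>\<^bsub>integer_mod_group l\<^esub> \<alpha> e))\<rparr>"

text \<open>
  The next two lemmas ensure that \<open>Max\<close> in \<open>density\<close> is a genuine maximum, for a graph and for
  its cyclic covers.
\<close>

lemma density_set_finite_nonempty:
  fixes G :: "('a, 'b) pre_digraph"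
  assumes "fin_digraph G" and "card (verts G) \<ge> 2"
  shows "finite {H. subgraph H G \<and> card (verts H) \<ge> 2}"
    and "{H. subgraph H G \<and> card (verts H) \<ge> 2} \<noteq> {}"
proof -
  interpret fin_digraph G by fact
  have "{H. subgraph H G \<and> card (verts H) \<ge> 2} \<subseteq>
      (\<lambda>(V, E). \<lparr>verts = V, arcs = E, tail = tail G, head = head G\<rparr>) ` (Pow (verts G) \<times> Pow (arcs G))"
  proof
    fix H assume "H \<in> {H. subgraph H G \<and> card (verts H) \<ge> 2}"
    then have "verts H \<subseteq> verts G" "arcs H \<subseteq> arcs G"
      "H = \<lparr>verts = verts H, arcs = arcs H, tail = tail G, head = head G\<rparr>"
      by (auto simp: subgraph_def compatible_def)
    then show "H \<in> (\<lambda>(V, E). \<lparr>verts = V, arcs = E, tail = tail G, head = head G\<rparr>) `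
        (Pow (verts G) \<times> Pow (arcs G))"
      by (intro image_eqI[where x = "(verts H, arcs H)"]) auto
  qed
  then show "finite {H. subgraph H G \<and> card (verts H) \<ge> 2}"
    by (rule finite_subset) simp
  show "{H. subgraph H G \<and> card (verts H) \<ge> 2} \<noteq> {}"
    using subgraph_refl assms(2) by blast
qed

lemma cyclic_cover_graph:
  assumes "fin_digraph G" "loopfree_digraph G" "l \<ge> 1"
    and "\<alpha> \<in> arcs G \<rightarrow> carrier (integer_mod_group l)"
  shows "fin_digraph (cyclic_cover G l \<alpha>)" "loopfree_digraph (cyclic_cover G l \<alpha>)"
proof -
  interpret fin_digraph G by fact
  interpret loopfree_digraph G by fact
  have wf: "wf_digraph (cyclic_cover G l \<alpha>)"
    using assms(3,4)
    by unfold_locales (auto simp: cyclic_cover_def integer_mod_group_def)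
  then interpret C: wf_digraph "cyclic_cover G l \<alpha>" .
  show "fin_digraph (cyclic_cover G l \<alpha>)"
    using assms(3)
    by unfold_locales (auto simp: cyclic_cover_def integer_mod_group_def)
  show "loopfree_digraph (cyclic_cover G l \<alpha>)"
    by unfold_locales (auto simp: cyclic_cover_def dest: no_loops)
qed

end

theory Submission
  imports Defs
begin

text \<open>
  Write \<open>k\<close> for the density of \<open>G\<close>. It is the least integer \<open>k \<ge> 0\<close> such that every
  vertex set \<open>S\<close> spans at most \<open>k * \<lfloor>|S| / 2\<rfloor>\<close> edges, so it suffices to bound edge counts in the
  cover.

  Let \<open>H\<close> be a subgraph of the cover, and let \<open>n v\<close> be the number of vertices of \<open>H\<close> in the fibre
  over \<open>v\<close>. The lifts of an edge \<open>uv\<close> form a perfect matching between the fibres over \<open>u\<close> and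
  \<open>v\<close>, so at most \<open>min (n u) (n v)\<close> of them lie in \<open>H\<close>. Now slice \<open>G\<close> by the level sets
  \<open>S\<^sub>j = {v. j < n v}\<close>, where \<open>0 \<le> j < l\<close>. The edge \<open>uv\<close> is spanned by exactly
  \<open>min (n u) (n v)\<close> of these sets, and the sizes of these sets add up to \<open>|H|\<close>. Hence
  \<open>|E(H)| \<le> (\<Sum>j. |E(G[S\<^sub>j])|) \<le> k * (\<Sum>j. \<lfloor>|S\<^sub>j| / 2\<rfloor>) \<le> k * \<lfloor>|H| / 2\<rfloor>\<close>,
  the last step because the floor function is superadditive. The voltages enter only through the
  matching property.
\<close>

section \<open>Density as a bound on the number of spanned edges\<close>

lemma ceiling_density_le_iff:
  assumes "n \<ge> 2"
  shows "\<lceil>real m / real_of_int \<lfloor>real n / 2\<rfloor>\<rceil> \<le> k \<longleftrightarrow> int m \<le> k * int (n div 2)"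
proof -
  have "\<lfloor>real n / 2\<rfloor> = int (n div 2)"
    using floor_divide_of_nat_eq[of n 2] by simp
  moreover have "n div 2 > 0"
    using assms by simp
  ultimately have "\<lceil>real m / real_of_int \<lfloor>real n / 2\<rfloor>\<rceil> \<le> k
      \<longleftrightarrow> real m \<le> of_int k * real (n div 2)"
    by (simp add: ceiling_le_iff divide_le_eq)
  also have "\<dots> \<longleftrightarrow> real_of_int (int m) \<le> real_of_int (k * int (n div 2))"
    by simp
  finally show ?thesis
    by (simp only: of_int_le_iff)
qed

lemma density_le_iff:
  assumes "fin_digraph G" "card (verts G) \<ge> 2"
  shows "density G \<le> k \<longleftrightarrow>
    (\<forall>H. subgraph H G \<and> card (verts H) \<ge> 2 \<longrightarrow>
      int (card (arcs H)) \<le> k * int (card (verts H) div 2))"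
proof -
  let ?f = "\<lambda>H. \<lceil>real (card (arcs H)) / real_of_int \<lfloor>real (card (verts H)) / 2\<rfloor>\<rceil>"
  let ?S = "{H. subgraph H G \<and> card (verts H) \<ge> 2}"
  have "density G = Max (?f ` ?S)"
    using assms(2) by (simp add: density_def image_Collect)
  moreover have "finite (?f ` ?S)" "?f ` ?S \<noteq> {}"
    using density_set_finite_nonempty[OF assms] by auto
  ultimately have "density G \<le> k \<longleftrightarrow> (\<forall>H\<in>?S. ?f H \<le> k)"
    by (simp add: Max_le_iff)
  then show ?thesis
    using ceiling_density_le_iff by auto
qed

lemma density_nonneg:
  assumes "fin_digraph G"
  shows "0 \<le> density G"
proof (cases "card (verts G) < 2")
  case True
  then show ?thesis by (simp add: density_def)
next
  case False
  interpret fin_digraph G by fact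
  have "0 \<le> density G * int (card (verts G) div 2)"
    using density_le_iff[OF assms, of "density G"] False subgraph_refl
    by (smt (verit) not_less of_nat_0_le_iff)
  moreover have "int (card (verts G) div 2) > 0"
    using False by simp
  ultimately show ?thesis
    by (simp add: zero_le_mult_iff)
qed

text \<open>
  If \<open>S\<close> has at least two vertices, this is the defining property of the density, applied to the induced
  subgraph. A set of at most one vertex spans nothing because there are no loops; these sets are
  included because level sets can be that small.
\<close>

lemma card_spanned_arcs_le_density:
  assumes "fin_digraph G" "loopfree_digraph G" "S \<subseteq> verts G"
  shows "int (card {e \<in> arcs G. tail G e \<in> S \<and> head G e \<in> S}) \<le> density G * int (card S div 2)"
proof -
  interpret fin_digraph G by fact
  interpret loopfree_digraph G by fact
  have "finite S"
    using finite_subset[OF assms(3) finite_verts] .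
  show ?thesis
  proof (cases "card S \<ge> 2")
    case True
    then have "card (verts G) \<ge> 2"
      using card_mono[OF finite_verts assms(3)] by linarith
    moreover have "subgraph (G \<restriction> S) G"
      using assms(3) by (rule subgraph_induce_subgraphI)
    ultimately have "int (card (arcs (G \<restriction> S))) \<le> density G * int (card (verts (G \<restriction> S)) div 2)"
      using density_le_iff[OF assms(1), of "density G"] True by auto
    then show ?thesis
      by (simp add: induce_subgraph_def)
  next
    case False
    have "u = v" if "u \<in> S" "v \<in> S" for u v
      using False card_le_Suc0_iff_eq[OF \<open>finite S\<close>] that by simp
    then have no_arcs: "{e \<in> arcs G. tail G e \<in> S \<and> head G e \<in> S} = {}"
      using no_loops by blast
    show ?thesis
      unfolding no_arcs using density_nonneg[OF assms(1)] by simp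
  qed
qed

section \<open>Counting by level sets\<close>

lemma sum_eq_sum_card_level_sets:
  fixes f :: "'a \<Rightarrow> nat"
  assumes "finite A" "\<And>a. a \<in> A \<Longrightarrow> f a \<le> l"
  shows "sum f A = (\<Sum>j<l. card {a \<in> A. j < f a})"
proof -
  have "f a = (\<Sum>j<l. if j < f a then 1 else 0)" if "a \<in> A" for a
  proof -
    have "{..<l} \<inter> {j. j < f a} = {..<f a}"
      using assms(2)[OF that] by auto
    then show ?thesis
      by (simp add: sum.If_cases)
  qed
  then have "sum f A = (\<Sum>a\<in>A. \<Sum>j<l. if j < f a then 1 else 0)"
    by (rule sum.cong[OF refl])
  also have "\<dots> = (\<Sum>j<l. \<Sum>a\<in>A. if j < f a then 1 else 0)"
    by (rule sum.swap)
  also have "\<dots> = (\<Sum>j<l. card {a \<in> A. j < f a})"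
    using assms(1) by (simp add: sum.If_cases Int_def)
  finally show ?thesis .
qed

lemma sum_div2_le_div2_sum:
  fixes f :: "'a \<Rightarrow> nat"
  shows "(\<Sum>a\<in>A. f a div 2) \<le> sum f A div 2"
proof -
  have "(\<Sum>a\<in>A. f a div 2) * 2 \<le> sum f A"
    unfolding sum_distrib_right by (rule sum_mono) simp
  then show ?thesis
    by simp
qed

text \<open>
  A fractional form of the edge bound: integer vertex weights in place of a vertex set, each edge
  weighted by the smaller of its two ends. It follows by summing the edge bound over the level sets
  of \<open>n\<close>.
\<close>

lemma sum_min_weight_le_density:
  fixes n :: "'a \<Rightarrow> nat"
  assumes "fin_digraph G" "loopfree_digraph G"
  shows "int (\<Sum>e\<in>arcs G. min (n (tail G e)) (n (head G e)))
    \<le> density G * int ((\<Sum>v\<in>verts G. n v) div 2)"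
proof -
  interpret fin_digraph G by fact
  define l where "l = Max (insert 0 (n ` verts G))"
  have n_le: "n v \<le> l" if "v \<in> verts G" for v
    unfolding l_def using that by (intro Max_ge) auto
  define S where "S j = {v \<in> verts G. j < n v}" for j
  have "(\<Sum>e\<in>arcs G. min (n (tail G e)) (n (head G e)))
      = (\<Sum>j<l. card {e \<in> arcs G. j < min (n (tail G e)) (n (head G e))})"
    by (intro sum_eq_sum_card_level_sets) (auto simp: n_le min_le_iff_disj)
  also have "\<dots> = (\<Sum>j<l. card {e \<in> arcs G. tail G e \<in> S j \<and> head G e \<in> S j})"
    by (intro sum.cong arg_cong[where f = card]) (auto simp: S_def)
  finally have "int (\<Sum>e\<in>arcs G. min (n (tail G e)) (n (head G e)))
      = (\<Sum>j<l. int (card {e \<in> arcs G. tail G e \<in> S j \<and> head G e \<in> S j}))"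
    by simp
  also have "\<dots> \<le> (\<Sum>j<l. density G * int (card (S j) div 2))"
    by (intro sum_mono card_spanned_arcs_le_density[OF assms]) (auto simp: S_def)
  also have "\<dots> = density G * int (\<Sum>j<l. card (S j) div 2)"
    by (simp add: sum_distrib_left)
  also have "\<dots> \<le> density G * int ((\<Sum>j<l. card (S j)) div 2)"
    using density_nonneg[OF assms(1)] sum_div2_le_div2_sum
    by (intro mult_left_mono) (simp_all only: of_nat_le_iff)
  also have "(\<Sum>j<l. card (S j)) = (\<Sum>v\<in>verts G. n v)"
    unfolding S_def using n_le by (intro sum_eq_sum_card_level_sets[symmetric]) auto
  finally show ?thesis .
qed

section \<open>Subgraphs of a cyclic cover\<close>

text \<open>
  An edge \<open>(e, i)\<close> over \<open>e\<close> is determined by its tail \<open>(t(e), i)\<close>, and also by its head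
  \<open>(h(e), i + \<alpha>(e))\<close> because translation by \<open>\<alpha>(e)\<close> is injective. Hence neither fibre of \<open>H\<close>
  at the ends of \<open>e\<close> can be smaller than the set of edges of \<open>H\<close> over \<open>e\<close>.
\<close>

lemma card_lifted_arcs_le:
  assumes "fin_digraph H" "subgraph H (cyclic_cover G l \<alpha>)"
    and "e \<in> arcs G" "\<alpha> e \<in> carrier (integer_mod_group l)"
  shows "card (Pair e -` arcs H)
    \<le> min (card (Pair (tail G e) -` verts H)) (card (Pair (head G e) -` verts H))"
proof -
  interpret H: fin_digraph H by fact
  interpret Z: group "integer_mod_group l" by simp
  let ?g = "\<lambda>i. i \<otimes>\<^bsub>integer_mod_group l\<^esub> \<alpha> e"
  have fin: "finite (Pair v -` verts H)" for v
    by (intro finite_vimageI H.finite_verts) (simp add: inj_on_def)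
  have ends: "tail H (e, i) = (tail G e, i)" "head H (e, i) = (head G e, ?g i)" for i
  proof -
    have "tail H = tail (cyclic_cover G l \<alpha>)" "head H = head (cyclic_cover G l \<alpha>)"
      using assms(2) by (simp_all add: subgraph_def compatible_def)
    then show "tail H (e, i) = (tail G e, i)" "head H (e, i) = (head G e, ?g i)"
      by (simp_all add: cyclic_cover_def)
  qed
  have tails: "Pair e -` arcs H \<subseteq> Pair (tail G e) -` verts H"
  proof
    fix i assume "i \<in> Pair e -` arcs H"
    then show "i \<in> Pair (tail G e) -` verts H"
      using H.tail_in_verts[of "(e, i)"] unfolding ends by simp
  qed
  have heads: "?g ` (Pair e -` arcs H) \<subseteq> Pair (head G e) -` verts H"
  proof (rule image_subsetI)
    fix i assume "i \<in> Pair e -` arcs H"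
    then show "?g i \<in> Pair (head G e) -` verts H"
      using H.head_in_verts[of "(e, i)"] unfolding ends by (simp del: mult_integer_mod_group)
  qed
  have "Pair e -` arcs H \<subseteq> carrier (integer_mod_group l)"
    using assms(2) by (auto simp: subgraph_def cyclic_cover_def)
  then have "inj_on ?g (Pair e -` arcs H)"
    using Z.right_cancel assms(4) unfolding inj_on_def by blast
  then show ?thesis
    by (intro min.boundedI card_mono[OF fin tails] card_inj_on_le[OF _ heads fin])
qed

lemma card_eq_sum_card_fibres:
  assumes "finite X" "finite A" "X \<subseteq> A \<times> UNIV"
  shows "card X = (\<Sum>a\<in>A. card (Pair a -` X))"
proof -
  have "X = Sigma A (\<lambda>a. Pair a -` X)"
    using assms(3) by auto
  moreover have "finite (Pair a -` X)" for a
    by (intro finite_vimageI assms(1)) (simp add: inj_on_def)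
  ultimately show ?thesis
    using card_SigmaI[of A "\<lambda>a. Pair a -` X"] assms(2) by simp
qed

theorem theorem2p1:
  fixes G :: "('a, 'b) pre_digraph" and l :: nat and \<alpha> :: "'b \<Rightarrow> int"
  assumes "fin_digraph G" and "loopfree_digraph G"
    and "l \<ge> 1"
    and "\<alpha> \<in> arcs G \<rightarrow> carrier (integer_mod_group l)"
  shows "density (cyclic_cover G l \<alpha>) \<le> density G"
proof (cases "card (verts (cyclic_cover G l \<alpha>)) < 2")
  case True
  then show ?thesis
    using density_nonneg[OF assms(1)] by (simp add: density_def)
next
  case False
  interpret fin_digraph G by fact
  have cover: "fin_digraph (cyclic_cover G l \<alpha>)"
    using cyclic_cover_graph[OF assms] by simp
  have "int (card (arcs H)) \<le> density G * int (card (verts H) div 2)"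
    if H: "subgraph H (cyclic_cover G l \<alpha>)" for H
  proof -
    have finH: "fin_digraph H"
      using fin_digraph.fin_digraph_subgraph[OF cover H] .
    then interpret H: fin_digraph H .
    let ?n = "\<lambda>v. card (Pair v -` verts H)"
    have sub: "verts H \<subseteq> verts G \<times> UNIV" "arcs H \<subseteq> arcs G \<times> UNIV"
      using H by (auto simp: subgraph_def cyclic_cover_def)
    have "card (arcs H) = (\<Sum>e\<in>arcs G. card (Pair e -` arcs H))"
      by (intro card_eq_sum_card_fibres sub) simp_all
    also have "\<dots> \<le> (\<Sum>e\<in>arcs G. min (?n (tail G e)) (?n (head G e)))"
      using assms(4) by (intro sum_mono card_lifted_arcs_le[OF finH H]) auto
    finally have "int (card (arcs H)) \<le> int (\<Sum>e\<in>arcs G. min (?n (tail G e)) (?n (head G e)))"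
      by (simp only: of_nat_le_iff)
    also have "\<dots> \<le> density G * int ((\<Sum>v\<in>verts G. ?n v) div 2)"
      by (rule sum_min_weight_le_density[OF assms(1,2)])
    also have "(\<Sum>v\<in>verts G. ?n v) = card (verts H)"
      by (intro card_eq_sum_card_fibres[symmetric] sub) simp_all
    finally show ?thesis .
  qed
  then show ?thesis
    using False density_le_iff[OF cover] by simp
qed

end
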